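(* Let $X$ be an ordered group and $P$ an admissible positive cone in $\mathrm{Aut}(X)$. Let $\mathcal{S}_X$ be the category of those split extensions $X\xrightarrow{\langle 1,0\rangle}X\rtimes_\varphi B\xrightarrow{\pi_2}B$, with section $\langle 0,1\rangle\colon B\to X\rtimes_\varphi B$, in $\mathsf{OrdGrp}$ with kernel $X$ such that: (1) for all $b\in P_B$, $\varphi_b\in P$; (2) for all $x\in X$, $x\geq 0$ provided that there exists $b\in P_B$ with $(x,b)\geq 0$ in $X\rtimes_\varphi B$ and $\varphi_b\sim\mathrm{id}$ in $\mathrm{Aut}_P(X)$. Then the maximal point $$X\xrightarrow{\langle 1,0\rangle}X\rtimes \mathrm{Aut}_P(X)\xrightarrow{\pi_2}\mathrm{Aut}_P(X),\qquad \langle 0,1\rangle\colon \mathrm{Aut}_P(X)\to X\rtimes \mathrm{Aut}_P(X),$$ classifies $\mathcal{S}_X$, i.e. it is a terminal object of $\mathcal{S}_X$.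
   Context: "Order" means preorder (reflexive and transitive, not necessarily antisymmetric). An ordered group is a (not necessarily abelian) group, written additively, with an order $\leq$ for which addition is monotone. Write $x\sim y$ for $x\leq y$ and $y\leq x$, and $x>0$ for $x\geq 0$ and not $x\sim 0$. The positive cone of an ordered group $B$ is $P_B=\{b\in B: b\geq 0\}$; a positive cone on a group is a submonoid closed under conjugation, and positive cones correspond bijectively to group orders. $\mathsf{OrdGrp}$ is the category of ordered groups and monotone group homomorphisms. A split extension in $\mathsf{OrdGrp}$ with kernel $X$ is a sequence $X\xrightarrow{k}A\xrightarrow{f}B$ with $k$ a kernel of $f$ and $f$ a cokernel of $k$, together with a morphism $s\colon B\to A$ such that $f\cdot s=\mathrm{id}_B$ (a kernel in $\mathsf{OrdGrp}$ is the group-theoretic kernel with the induced order); also called a point. Up to isomorphism, $A$ is as a group a semidirect product $X\rtimes_\varphi B$ (operation $(x,b)+(x',b')=(x+\varphi_b(x'),b+b')$) for an action $\varphi$ of $B$ on $X$ by automorphisms $\varphi_b$, with $\langle 1,0\rangle(x)=(x,0)$, $\pi_2(x,b)=b$, $\langle 0,1\rangle(b)=(0,b)$, and with some order on $X\rtimes_\varphi B$; each $\varphi_b$ is then monotone. Morphisms between split extensions $(k,f\colon A\to B,s)$ and $(k',f'\colon A'\to B',s')$ with kernel $X$ are pairs of morphisms $t\colon A\to A'$, $c\colon B\to B'$ in $\mathsf{OrdGrp}$ with $t\cdot k=k'$, $f'\cdot t=c\cdot f$ and $t\cdot s=s'\cdot c$; $\mathcal{S}_X$ is a full subcategory of this category.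 $\mathrm{Aut}(X)$ is the group (under composition) of monotone group automorphisms of $X$, and $\mathrm{Aut}_P(X)$ is $\mathrm{Aut}(X)$ equipped with the order with positive cone $P$. The positive cone $P$ is admissible if $\alpha\sim\mathrm{id}$ in $\mathrm{Aut}_P(X)$ implies $\alpha\sim\mathrm{id}$ pointwise, i.e. $\alpha(x)\sim x$ for all $x\in X$; equivalently, if there is an order on $X\rtimes\mathrm{Aut}(X)$ (operation $(x,\alpha)+(x',\alpha')=(x+\alpha(x'),\alpha\cdot\alpha')$) making the displayed sequence a split extension in $\mathsf{OrdGrp}$. A split extension is maximal if the semidirect product carries the lexicographic order; here its positive cone is $\{(x,\alpha): \alpha>\mathrm{id}\text{ in }\mathrm{Aut}_P(X),\text{ or }(\alpha\sim \mathrm{id}\text{ in }\mathrm{Aut}_P(X)\text{ and }x\geq 0)\}$, where $\alpha>\mathrm{id}$ means $\alpha\in P$ and not $\alpha\sim\mathrm{id}$ in $\mathrm{Aut}_P(X)$. *)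

theory Defs
  imports "HOL-Algebra.Bij" "HOL-Algebra.Coset"
begin

(* Groups are written multiplicatively, as in HOL-Algebra, but need not be abelian.
   Maps between carriers are extensional, so that equality of maps is equality on carriers. *)

section \<open>Preordered groups\<close>

record 'a ordgrp = "'a monoid" +
  leq :: "'a \<Rightarrow> 'a \<Rightarrow> bool" (infix \<open>\<preceq>\<index>\<close> 50)

locale ordered_group = group G for G :: "'a ordgrp" (structure) +
  assumes leq_refl: "reflp_on (carrier G) (leq G)"
    and leq_trans: "transp_on (carrier G) (leq G)"
    and mult_mono: "\<lbrakk>x \<in> carrier G; y \<in> carrier G; x' \<in> carrier G; y' \<in> carrier G; x \<preceq> y; x' \<preceq> y'\<rbrakk>
      \<Longrightarrow> x \<otimes> x' \<preceq> y \<otimes> y'"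

definition leq_equiv :: "'a ordgrp \<Rightarrow> 'a \<Rightarrow> 'a \<Rightarrow> bool" (infix \<open>\<sim>\<index>\<close> 50)
  where "leq_equiv G x y \<longleftrightarrow> leq G x y \<and> leq G y x"

definition pos_cone :: "'a ordgrp \<Rightarrow> 'a set"
  where "pos_cone G = {x \<in> carrier G. \<one>\<^bsub>G\<^esub> \<preceq>\<^bsub>G\<^esub> x}"

definition positive_cone :: "('a, 'm) monoid_scheme \<Rightarrow> 'a set \<Rightarrow> bool"
  where "positive_cone G P \<longleftrightarrow> submonoid P G \<and>
    (\<forall>g \<in> carrier G. \<forall>p \<in> P. g \<otimes>\<^bsub>G\<^esub> p \<otimes>\<^bsub>G\<^esub> inv\<^bsub>G\<^esub> g \<in> P)"

definition with_order :: "('a, 'm) monoid_scheme \<Rightarrow> ('a \<Rightarrow> 'a \<Rightarrow> bool) \<Rightarrow> 'a ordgrp"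
  where "with_order G r = \<lparr>carrier = carrier G, monoid.mult = monoid.mult G, one = one G, leq = r\<rparr>"

definition with_cone :: "('a, 'm) monoid_scheme \<Rightarrow> 'a set \<Rightarrow> 'a ordgrp"
  where "with_cone G P = with_order G (\<lambda>x y. y \<otimes>\<^bsub>G\<^esub> inv\<^bsub>G\<^esub> x \<in> P)"

definition ord_hom :: "'a ordgrp \<Rightarrow> 'b ordgrp \<Rightarrow> ('a \<Rightarrow> 'b) set"
  where "ord_hom G H = {h \<in> hom G H \<inter> extensional (carrier G). monotone_on (carrier G) (leq G) (leq H) h}"


section \<open>Split extensions\<close>

definition is_kernel :: "'x ordgrp \<Rightarrow> ('x \<Rightarrow> 'a) \<Rightarrow> 'a ordgrp \<Rightarrow> ('a \<Rightarrow> 'b) \<Rightarrow> 'b ordgrp \<Rightarrow> bool"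
  where "is_kernel X k A f B \<longleftrightarrow> k \<in> ord_hom X A \<and> inj_on k (carrier X) \<and>
    k ` carrier X = kernel A B f \<and>
    (\<forall>x \<in> carrier X. \<forall>y \<in> carrier X. x \<preceq>\<^bsub>X\<^esub> y \<longleftrightarrow> k x \<preceq>\<^bsub>A\<^esub> k y)"

(* The universal property is tested against ordered groups on the type 'c. In a statement with
   'c free, being a cokernel is thus expressed for test objects on all types. *)
definition is_cokernel ::
  "'c itself \<Rightarrow> 'x ordgrp \<Rightarrow> ('x \<Rightarrow> 'a) \<Rightarrow> 'a ordgrp \<Rightarrow> ('a \<Rightarrow> 'b) \<Rightarrow> 'b ordgrp \<Rightarrow> bool"
  where "is_cokernel T X k A f B \<longleftrightarrow> f \<in> ord_hom A B \<and> (\<forall>x \<in> carrier X. f (k x) = \<one>\<^bsub>B\<^esub>) \<and>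
    (\<forall>C :: 'c ordgrp. \<forall>g. ordered_group C \<and> g \<in> ord_hom A C \<and> (\<forall>x \<in> carrier X. g (k x) = \<one>\<^bsub>C\<^esub>)
      \<longrightarrow> (\<exists>!h. h \<in> ord_hom B C \<and> compose (carrier A) h f = g))"

record ('x, 'a, 'b) point =
  ker_map :: "'x \<Rightarrow> 'a"
  total :: "'a ordgrp"
  proj :: "'a \<Rightarrow> 'b"
  base :: "'b ordgrp"
  sect :: "'b \<Rightarrow> 'a"

definition split_extension :: "'c itself \<Rightarrow> 'x ordgrp \<Rightarrow> ('x, 'a, 'b) point \<Rightarrow> bool"
  where "split_extension T X E \<longleftrightarrow>
    ordered_group X \<and> ordered_group (total E) \<and> ordered_group (base E) \<and>
    sect E \<in> ord_hom (base E) (total E) \<and>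
    is_kernel X (ker_map E) (total E) (proj E) (base E) \<and>
    is_cokernel T X (ker_map E) (total E) (proj E) (base E) \<and>
    (\<forall>b \<in> carrier (base E). proj E (sect E b) = b)"

definition point_hom ::
  "'x ordgrp \<Rightarrow> ('x, 'a, 'b) point \<Rightarrow> ('x, 'c, 'd) point \<Rightarrow> (('a \<Rightarrow> 'c) \<times> ('b \<Rightarrow> 'd)) set"
  where "point_hom X E E' = {(t, c).
    t \<in> ord_hom (total E) (total E') \<and>
    c \<in> ord_hom (base E) (base E') \<and>
    (\<forall>x \<in> carrier X. t (ker_map E x) = ker_map E' x) \<and>
    (\<forall>a \<in> carrier (total E). proj E' (t a) = c (proj E a)) \<and>
    (\<forall>b \<in> carrier (base E). t (sect E b) = sect E' (c b))}"


section \<open>Semidirect products\<close>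

definition semidirect ::
  "('x, 'm) monoid_scheme \<Rightarrow> ('b, 'n) monoid_scheme \<Rightarrow> ('b \<Rightarrow> 'x \<Rightarrow> 'x) \<Rightarrow> ('x \<times> 'b) monoid"
  where "semidirect X B \<phi> = \<lparr>
    carrier = carrier X \<times> carrier B,
    monoid.mult = (\<lambda>(x, b) (x', b'). (x \<otimes>\<^bsub>X\<^esub> \<phi> b x', b \<otimes>\<^bsub>B\<^esub> b')),
    one = (\<one>\<^bsub>X\<^esub>, \<one>\<^bsub>B\<^esub>)\<rparr>"

definition semidirect_point :: "'x ordgrp \<Rightarrow> 'b ordgrp \<Rightarrow> ('b \<Rightarrow> 'x \<Rightarrow> 'x) \<Rightarrow>
    ('x \<times> 'b \<Rightarrow> 'x \<times> 'b \<Rightarrow> bool) \<Rightarrow> ('x, 'x \<times> 'b, 'b) point"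
  where "semidirect_point X B \<phi> r = \<lparr>
    ker_map = (\<lambda>x \<in> carrier X. (x, \<one>\<^bsub>B\<^esub>)),
    total = with_order (semidirect X B \<phi>) r,
    proj = (\<lambda>(x, b) \<in> carrier X \<times> carrier B. b),
    base = B,
    sect = (\<lambda>b \<in> carrier B. (\<one>\<^bsub>X\<^esub>, b))\<rparr>"

definition lex_cone :: "'x ordgrp \<Rightarrow> 'b ordgrp \<Rightarrow> ('x \<times> 'b) set"
  where "lex_cone X B = {(x, b) \<in> carrier X \<times> carrier B.
    (\<one>\<^bsub>B\<^esub> \<preceq>\<^bsub>B\<^esub> b \<and> \<not> b \<sim>\<^bsub>B\<^esub> \<one>\<^bsub>B\<^esub>) \<or> (b \<sim>\<^bsub>B\<^esub> \<one>\<^bsub>B\<^esub> \<and> \<one>\<^bsub>X\<^esub> \<preceq>\<^bsub>X\<^esub> x)}"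


section \<open>Automorphisms and the classifying point\<close>

(* The inverse of a monotone bijective homomorphism of preordered groups need not be monotone;
   it is required to be, so that the automorphisms form a group. *)
definition Aut :: "'x ordgrp \<Rightarrow> ('x \<Rightarrow> 'x) monoid"
  where "Aut X = AutoGroup X \<lparr>carrier := {\<alpha> \<in> auto X.
    monotone_on (carrier X) (leq X) (leq X) \<alpha> \<and>
    monotone_on (carrier X) (leq X) (leq X) (inv_into (carrier X) \<alpha>)}\<rparr>"

abbreviation Aut_ord :: "'x ordgrp \<Rightarrow> ('x \<Rightarrow> 'x) set \<Rightarrow> ('x \<Rightarrow> 'x) ordgrp"
  where "Aut_ord X P \<equiv> with_cone (Aut X) P"

definition admissible_cone :: "'x ordgrp \<Rightarrow> ('x \<Rightarrow> 'x) set \<Rightarrow> bool"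
  where "admissible_cone X P \<longleftrightarrow> positive_cone (Aut X) P \<and>
    (\<forall>\<alpha> \<in> carrier (Aut X). \<alpha> \<sim>\<^bsub>Aut_ord X P\<^esub> \<one>\<^bsub>Aut X\<^esub> \<longrightarrow> (\<forall>x \<in> carrier X. \<alpha> x \<sim>\<^bsub>X\<^esub> x))"

(* The action is only assumed to be by group automorphisms; that each one is monotone follows
   by conjugation in the ordered semidirect product. *)
definition S_cat :: "'c itself \<Rightarrow> 'x ordgrp \<Rightarrow> ('x \<Rightarrow> 'x) set \<Rightarrow> ('x, 'x \<times> 'b, 'b) point set"
  where "S_cat T X P = {semidirect_point X B \<phi> r | B \<phi> r.
    \<phi> \<in> hom B (AutoGroup X) \<and>
    split_extension T X (semidirect_point X B \<phi> r) \<and>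
    (\<forall>b \<in> pos_cone B. \<phi> b \<in> P) \<and>
    (\<forall>x \<in> carrier X. (\<exists>b \<in> pos_cone B. r (\<one>\<^bsub>X\<^esub>, \<one>\<^bsub>B\<^esub>) (x, b) \<and> \<phi> b \<sim>\<^bsub>Aut_ord X P\<^esub> \<one>\<^bsub>Aut X\<^esub>)
      \<longrightarrow> \<one>\<^bsub>X\<^esub> \<preceq>\<^bsub>X\<^esub> x)}"

definition maximal_point :: "'x ordgrp \<Rightarrow> ('x \<Rightarrow> 'x) set \<Rightarrow> ('x, 'x \<times> ('x \<Rightarrow> 'x), 'x \<Rightarrow> 'x) point"
  where "maximal_point X P = semidirect_point X (Aut_ord X P) (\<lambda>\<alpha>. \<alpha>)
    (leq (with_cone (semidirect X (Aut_ord X P) (\<lambda>\<alpha>. \<alpha>)) (lex_cone X (Aut_ord X P))))"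

end

theory Submission
  imports Defs
begin

text \<open>
  The morphism from a split extension in \<open>S_X\<close> with action \<open>\<phi>\<close> to the maximal point is
  \<open>(x, b) \<mapsto> (x, \<phi> b)\<close> over \<open>\<phi>\<close>. Condition (1) makes \<open>\<phi>\<close> monotone. If \<open>(x, b) \<ge> 0\<close>
  then \<open>b \<ge> 0\<close>, hence \<open>\<phi> b \<ge> id\<close>, and condition (2) says precisely that \<open>x \<ge> 0\<close> when
  \<open>\<phi> b \<sim> id\<close>: this is membership in the lexicographic cone. A morphism of points is
  determined by its component \<open>c\<close> on the base, and applying it to \<open>b + x = \<phi> b x + b\<close>
  gives \<open>c b = \<phi> b\<close>. For the maximal point itself, admissibility is what makes the
  lexicographic cone closed under addition and conjugation.
\<close>

section \<open>Orders and positive cones\<close>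

lemma with_order_simps [simp]:
  "carrier (with_order G r) = carrier G"
  "monoid.mult (with_order G r) = monoid.mult G"
  "one (with_order G r) = one G"
  "leq (with_order G r) = r"
  by (simp_all add: with_order_def)

lemma m_inv_with_order [simp]: "m_inv (with_order G r) = m_inv G"
  by (simp add: m_inv_def fun_eq_iff)

lemma with_cone_simps [simp]:
  "carrier (with_cone G P) = carrier G"
  "monoid.mult (with_cone G P) = monoid.mult G"
  "one (with_cone G P) = one G"
  "leq (with_cone G P) x y \<longleftrightarrow> y \<otimes>\<^bsub>G\<^esub> inv\<^bsub>G\<^esub> x \<in> P"
  by (simp_all add: with_cone_def)

lemma m_inv_with_cone [simp]: "m_inv (with_cone G P) = m_inv G"
  by (simp add: with_cone_def)

text \<open>Points on a semidirect product take their order as a relation, while the lexicographic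
  order is given by a cone; this translates between the two presentations of the total
  group.\<close>

lemma with_cone_eq_with_order: "with_order G (leq (with_cone G P)) = with_cone G P"
  by (simp add: with_cone_def)

lemma group_with_order [simp]: "group (with_order G r) \<longleftrightarrow> group G"
  unfolding group_def monoid_def group_axioms_def Units_def with_order_simps ..

lemma group_with_cone [simp]: "group (with_cone G P) \<longleftrightarrow> group G"
  by (simp add: with_cone_def)

context ordered_group
begin

lemma le_refl [simp]: "x \<in> carrier G \<Longrightarrow> x \<preceq> x"
  using leq_refl by (simp add: reflp_on_def)

lemma le_trans: "\<lbrakk>x \<preceq> y; y \<preceq> z; x \<in> carrier G; y \<in> carrier G; z \<in> carrier G\<rbrakk> \<Longrightarrow> x \<preceq> z"
  using leq_trans by (blast dest: transp_onD)

text \<open>Multiplication on the right by \<open>inv x\<close>, respectively by \<open>x\<close>,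
  is monotone. The quotient is formed on the same side as in \<open>with_cone\<close>, so orders and
  cones can be exchanged directly.\<close>

lemma le_iff_one_le:
  assumes "x \<in> carrier G" "y \<in> carrier G"
  shows "x \<preceq> y \<longleftrightarrow> \<one> \<preceq> y \<otimes> inv x"
proof
  assume "x \<preceq> y"
  then show "\<one> \<preceq> y \<otimes> inv x"
    using mult_mono[of x y "inv x" "inv x"] assms by simp
next
  assume "\<one> \<preceq> y \<otimes> inv x"
  then show "x \<preceq> y"
    using mult_mono[of \<one> "y \<otimes> inv x" x x] assms by (simp add: m_assoc)
qed

lemma one_le_mult: "\<lbrakk>\<one> \<preceq> x; \<one> \<preceq> y; x \<in> carrier G; y \<in> carrier G\<rbrakk> \<Longrightarrow> \<one> \<preceq> x \<otimes> y"
  using mult_mono[of \<one> x \<one> y] by simp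

lemma conj_mono:
  assumes "x \<preceq> y" "x \<in> carrier G" "y \<in> carrier G" "g \<in> carrier G"
  shows "g \<otimes> x \<otimes> inv g \<preceq> g \<otimes> y \<otimes> inv g"
  using assms by (intro mult_mono) auto

lemma one_le_conj: "\<lbrakk>\<one> \<preceq> x; x \<in> carrier G; g \<in> carrier G\<rbrakk> \<Longrightarrow> \<one> \<preceq> g \<otimes> x \<otimes> inv g"
  using conj_mono[of \<one> x g] by simp

text \<open>A homomorphism carries \<open>y \<otimes> inv x\<close> to the corresponding quotient of
  images, so monotonicity need only be tested on the positive cone. Conditions on the cones thereby
  yield morphisms of ordered groups.\<close>

lemma monotone_homI:
  assumes "ordered_group H" "h \<in> hom G H"
    and pos: "\<And>x. \<lbrakk>x \<in> carrier G; \<one> \<preceq> x\<rbrakk> \<Longrightarrow> \<one>\<^bsub>H\<^esub> \<preceq>\<^bsub>H\<^esub> h x"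
  shows "monotone_on (carrier G) (leq G) (leq H) h"
proof (rule monotone_onI)
  interpret H: ordered_group H by fact
  interpret group_hom G H h using assms(2) by unfold_locales
  fix x y assume xy: "x \<in> carrier G" "y \<in> carrier G" "x \<preceq> y"
  then have "\<one>\<^bsub>H\<^esub> \<preceq>\<^bsub>H\<^esub> h (y \<otimes> inv x)"
    using le_iff_one_le[of x y] by (intro pos) auto
  then show "h x \<preceq>\<^bsub>H\<^esub> h y"
    using xy by (simp add: H.le_iff_one_le[of "h x"])
qed

end

text \<open>Each order axiom uses one cone axiom: the unit gives reflexivity, closure under products
  transitivity, and closure under conjugation is what monotonicity requires in a non-abelian
  group.\<close>

lemma ordered_group_with_cone:
  assumes "group G" "positive_cone G P"
  shows "ordered_group (with_cone G P)"
proof -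
  interpret group G by fact
  interpret P: submonoid P G using assms(2) by (simp add: positive_cone_def)
  have cancel: "inv\<^bsub>G\<^esub> x \<otimes>\<^bsub>G\<^esub> (x \<otimes>\<^bsub>G\<^esub> y) = y" if "x \<in> carrier G" "y \<in> carrier G" for x y
    using that by (simp flip: m_assoc)
  have conj: "g \<otimes>\<^bsub>G\<^esub> p \<otimes>\<^bsub>G\<^esub> inv\<^bsub>G\<^esub> g \<in> P" if "g \<in> carrier G" "p \<in> P" for g p
    using assms(2) that by (simp add: positive_cone_def)
  show ?thesis
  proof (intro ordered_group.intro ordered_group_axioms.intro)
    show "transp_on (carrier (with_cone G P)) (leq (with_cone G P))"
    proof (rule transp_onI, simp)
      fix x y z
      assume A: "x \<in> carrier G" "y \<in> carrier G" "z \<in> carrier G"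
        "y \<otimes>\<^bsub>G\<^esub> inv\<^bsub>G\<^esub> x \<in> P" "z \<otimes>\<^bsub>G\<^esub> inv\<^bsub>G\<^esub> y \<in> P"
      have "z \<otimes>\<^bsub>G\<^esub> inv\<^bsub>G\<^esub> x = (z \<otimes>\<^bsub>G\<^esub> inv\<^bsub>G\<^esub> y) \<otimes>\<^bsub>G\<^esub> (y \<otimes>\<^bsub>G\<^esub> inv\<^bsub>G\<^esub> x)"
        using A by (simp add: m_assoc cancel)
      then show "z \<otimes>\<^bsub>G\<^esub> inv\<^bsub>G\<^esub> x \<in> P" using A by simp
    qed
  next
    fix x y x' y'
    assume "x \<in> carrier (with_cone G P)" "y \<in> carrier (with_cone G P)"
      "x' \<in> carrier (with_cone G P)" "y' \<in> carrier (with_cone G P)"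
      "leq (with_cone G P) x y" "leq (with_cone G P) x' y'"
    then have A: "x \<in> carrier G" "y \<in> carrier G" "x' \<in> carrier G" "y' \<in> carrier G"
      "y \<otimes>\<^bsub>G\<^esub> inv\<^bsub>G\<^esub> x \<in> P" "y' \<otimes>\<^bsub>G\<^esub> inv\<^bsub>G\<^esub> x' \<in> P" by auto
    \<comment> \<open>The quotient of the products splits into a conjugate by \<open>y\<close> of
      the second quotient, times the first quotient. Both factors lie in \<open>P\<close>.\<close>
    have "(y \<otimes>\<^bsub>G\<^esub> y') \<otimes>\<^bsub>G\<^esub> inv\<^bsub>G\<^esub> (x \<otimes>\<^bsub>G\<^esub> x')
      = (y \<otimes>\<^bsub>G\<^esub> (y' \<otimes>\<^bsub>G\<^esub> inv\<^bsub>G\<^esub> x') \<otimes>\<^bsub>G\<^esub> inv\<^bsub>G\<^esub> y) \<otimes>\<^bsub>G\<^esub> (y \<otimes>\<^bsub>G\<^esub> inv\<^bsub>G\<^esub> x)"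
      using A by (simp add: m_assoc inv_mult_group cancel)
    then show "leq (with_cone G P) (x \<otimes>\<^bsub>with_cone G P\<^esub> x') (y \<otimes>\<^bsub>with_cone G P\<^esub> y')"
      using A conj by simp
  qed (use assms in \<open>auto simp: reflp_on_def\<close>)
qed


section \<open>Monotone automorphisms\<close>

lemma one_AutoGroup: "\<one>\<^bsub>AutoGroup X\<^esub> = (\<lambda>x \<in> carrier X. x)"
  by (simp add: AutoGroup_def BijGroup_def)

lemma carrier_AutoGroup: "carrier (AutoGroup X) = auto X"
  by (simp add: AutoGroup_def)

lemma mult_AutoGroup:
  "\<lbrakk>\<alpha> \<in> auto X; \<beta> \<in> auto X\<rbrakk> \<Longrightarrow> \<alpha> \<otimes>\<^bsub>AutoGroup X\<^esub> \<beta> = compose (carrier X) \<alpha> \<beta>"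
  by (simp add: AutoGroup_def BijGroup_def auto_def)

lemma auto_closed: "\<lbrakk>\<alpha> \<in> auto X; x \<in> carrier X\<rbrakk> \<Longrightarrow> \<alpha> x \<in> carrier X"
  by (auto simp: auto_def hom_def)

lemma auto_extensional: "\<alpha> \<in> auto X \<Longrightarrow> \<alpha> \<in> extensional (carrier X)"
  by (simp add: auto_def Bij_def)

lemma Aut_one_mult:
  "\<one>\<^bsub>Aut X\<^esub> = \<one>\<^bsub>AutoGroup X\<^esub>" "monoid.mult (Aut X) = monoid.mult (AutoGroup X)"
  by (simp_all add: Aut_def)

text \<open>Every element of the carrier is \<open>\<alpha> x\<close> for a unique \<open>x\<close>,
  so monotonicity of the inverse, tested at such points, says that \<open>\<alpha>\<close> reflects
  the order. The two monotonicity conditions merge into one equivalence free of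
  \<open>inv_into\<close>.\<close>

lemma carrier_Aut_iff:
  "\<alpha> \<in> carrier (Aut X) \<longleftrightarrow>
    \<alpha> \<in> auto X \<and> (\<forall>x \<in> carrier X. \<forall>y \<in> carrier X. x \<preceq>\<^bsub>X\<^esub> y \<longleftrightarrow> \<alpha> x \<preceq>\<^bsub>X\<^esub> \<alpha> y)"
proof -
  have "monotone_on (carrier X) (leq X) (leq X) (inv_into (carrier X) \<alpha>) \<longleftrightarrow>
    (\<forall>x \<in> carrier X. \<forall>y \<in> carrier X. \<alpha> x \<preceq>\<^bsub>X\<^esub> \<alpha> y \<longrightarrow> x \<preceq>\<^bsub>X\<^esub> y)" if "\<alpha> \<in> auto X"
  proof -
    have inj: "inj_on \<alpha> (carrier X)" and im: "\<alpha> ` carrier X = carrier X"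
      using that by (auto simp: auto_def Bij_def bij_betw_def)
    have "monotone_on (\<alpha> ` carrier X) (leq X) (leq X) (inv_into (carrier X) \<alpha>) \<longleftrightarrow>
      (\<forall>x \<in> carrier X. \<forall>y \<in> carrier X. \<alpha> x \<preceq>\<^bsub>X\<^esub> \<alpha> y \<longrightarrow> x \<preceq>\<^bsub>X\<^esub> y)"
      using inj by (simp add: monotone_on_def)
    then show ?thesis by (simp add: im)
  qed
  then show ?thesis
    by (auto simp: Aut_def monotone_on_def)
qed

lemma Aut_subset_auto: "\<alpha> \<in> carrier (Aut X) \<Longrightarrow> \<alpha> \<in> auto X"
  by (simp add: carrier_Aut_iff)

lemma Aut_le_iff:
  "\<lbrakk>\<alpha> \<in> carrier (Aut X); x \<in> carrier X; y \<in> carrier X\<rbrakk>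
    \<Longrightarrow> \<alpha> x \<preceq>\<^bsub>X\<^esub> \<alpha> y \<longleftrightarrow> x \<preceq>\<^bsub>X\<^esub> y"
  unfolding carrier_Aut_iff by blast

lemma AutI:
  "\<lbrakk>\<alpha> \<in> auto X; \<And>x y. \<lbrakk>x \<in> carrier X; y \<in> carrier X\<rbrakk> 
      \<Longrightarrow> \<alpha> x \<preceq>\<^bsub>X\<^esub> \<alpha> y \<longleftrightarrow> x \<preceq>\<^bsub>X\<^esub> y\<rbrakk>
    \<Longrightarrow> \<alpha> \<in> carrier (Aut X)"
  unfolding carrier_Aut_iff by blast

lemma subgroup_Aut:
  fixes X :: "'x ordgrp"
  assumes "group X"
  shows "subgroup (carrier (Aut X)) (AutoGroup X)"
proof -
  interpret A: group "AutoGroup X" using assms by (rule group.AutoGroup)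
  show ?thesis
  proof (rule A.subgroupI)
    have "\<one>\<^bsub>AutoGroup X\<^esub> \<in> carrier (Aut X)"
      using A.one_closed by (simp add: carrier_Aut_iff carrier_AutoGroup one_AutoGroup)
    then show "carrier (Aut X) \<noteq> {}" by blast
  next
    fix \<alpha> assume \<alpha>: "\<alpha> \<in> carrier (Aut X)"
    let ?\<beta> = "inv\<^bsub>AutoGroup X\<^esub> \<alpha>"
    have \<beta>: "?\<beta> \<in> auto X"
      using A.inv_closed \<alpha> by (simp add: Aut_subset_auto carrier_AutoGroup)
    have "compose (carrier X) \<alpha> ?\<beta> = (\<lambda>x \<in> carrier X. x)"
      using A.r_inv[of \<alpha>] \<alpha> \<beta> by (simp add: Aut_subset_auto carrier_AutoGroup mult_AutoGroup one_AutoGroup)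
    then have inv: "\<alpha> (?\<beta> x) = x" if "x \<in> carrier X" for x
      using that by (metis (no_types) compose_eq restrict_apply')
    show "?\<beta> \<in> carrier (Aut X)"
    proof (rule AutI[OF \<beta>])
      fix x y assume xy: "x \<in> carrier X" "y \<in> carrier X"
      \<comment> \<open>The equivalence for \<open>\<alpha>\<close> is read at the points
        \<open>?\<beta> x\<close> and \<open>?\<beta> y\<close>, which \<open>\<alpha>\<close> sends
        back to \<open>x\<close> and \<open>y\<close>.\<close>
      then show "?\<beta> x \<preceq>\<^bsub>X\<^esub> ?\<beta> y \<longleftrightarrow> x \<preceq>\<^bsub>X\<^esub> y"
        using Aut_le_iff[OF \<alpha>, of "?\<beta> x" "?\<beta> y"] \<beta> by (simp add: inv auto_closed)
    qed
  next
    fix \<alpha> \<beta> assume "\<alpha> \<in> carrier (Aut X)" "\<beta> \<in> carrier (Aut X)"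
    moreover from this have "\<alpha> \<otimes>\<^bsub>AutoGroup X\<^esub> \<beta> \<in> auto X"
      using A.m_closed by (simp add: Aut_subset_auto carrier_AutoGroup)
    ultimately show "\<alpha> \<otimes>\<^bsub>AutoGroup X\<^esub> \<beta> \<in> carrier (Aut X)"
      by (intro AutI) (simp_all add: Aut_subset_auto mult_AutoGroup compose_eq auto_closed Aut_le_iff)
  qed (auto simp: carrier_AutoGroup Aut_subset_auto)
qed

lemma group_Aut:
  fixes X :: "'x ordgrp"
  assumes "group X"
  shows "group (Aut X)"
proof -
  have "group (AutoGroup X\<lparr>carrier := carrier (Aut X)\<rparr>)"
    using assms by (intro subgroup.subgroup_is_group subgroup_Aut group.AutoGroup)
  then show ?thesis
    by (simp add: Aut_def)
qed


section \<open>Semidirect products\<close>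

lemma semidirect_simps [simp]:
  "carrier (semidirect X B \<phi>) = carrier X \<times> carrier B"
  "(x, b) \<otimes>\<^bsub>semidirect X B \<phi>\<^esub> (x', b') = (x \<otimes>\<^bsub>X\<^esub> \<phi> b x', b \<otimes>\<^bsub>B\<^esub> b')"
  "\<one>\<^bsub>semidirect X B \<phi>\<^esub> = (\<one>\<^bsub>X\<^esub>, \<one>\<^bsub>B\<^esub>)"
  by (simp_all add: semidirect_def)

lemma semidirect_point_simps [simp]:
  "ker_map (semidirect_point X B \<phi> r) = (\<lambda>x \<in> carrier X. (x, \<one>\<^bsub>B\<^esub>))"
  "total (semidirect_point X B \<phi> r) = with_order (semidirect X B \<phi>) r"
  "proj (semidirect_point X B \<phi> r) = (\<lambda>(x, b) \<in> carrier X \<times> carrier B. b)"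
  "base (semidirect_point X B \<phi> r) = B"
  "sect (semidirect_point X B \<phi> r) = (\<lambda>b \<in> carrier B. (\<one>\<^bsub>X\<^esub>, b))"
  by (simp_all add: semidirect_point_def)

locale semidirect_action = X: group X + B: group B
  for X :: "('x, 'm) monoid_scheme" and B :: "('b, 'n) monoid_scheme" +
  fixes \<phi> :: "'b \<Rightarrow> 'x \<Rightarrow> 'x"
  assumes action: "\<phi> \<in> hom B (AutoGroup X)"
begin

abbreviation S where "S \<equiv> semidirect X B \<phi>"

lemma act_auto: "b \<in> carrier B \<Longrightarrow> \<phi> b \<in> auto X"
  using action by (auto simp: hom_def carrier_AutoGroup)

lemma act_hom: "b \<in> carrier B \<Longrightarrow> \<phi> b \<in> hom X X"
  using act_auto by (simp add: auto_def)

lemma act_closed [simp]: "\<lbrakk>b \<in> carrier B; x \<in> carrier X\<rbrakk> \<Longrightarrow> \<phi> b x \<in> carrier X"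
  by (rule auto_closed[OF act_auto])

lemma act_distrib: "\<lbrakk>b \<in> carrier B; x \<in> carrier X; y \<in> carrier X\<rbrakk>
    \<Longrightarrow> \<phi> b (x \<otimes>\<^bsub>X\<^esub> y) = \<phi> b x \<otimes>\<^bsub>X\<^esub> \<phi> b y"
  by (rule hom_mult[OF act_hom])

lemma act_of_one [simp]: "b \<in> carrier B \<Longrightarrow> \<phi> b \<one>\<^bsub>X\<^esub> = \<one>\<^bsub>X\<^esub>"
  by (rule hom_one[OF act_hom X.is_group X.is_group])

lemma act_mult: "\<lbrakk>b \<in> carrier B; c \<in> carrier B; x \<in> carrier X\<rbrakk>
    \<Longrightarrow> \<phi> (b \<otimes>\<^bsub>B\<^esub> c) x = \<phi> b (\<phi> c x)"
  using hom_mult[OF action] by (simp add: mult_AutoGroup act_auto compose_eq)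

lemma act_one: "x \<in> carrier X \<Longrightarrow> \<phi> \<one>\<^bsub>B\<^esub> x = x"
  using hom_one[OF action B.is_group X.AutoGroup] by (simp add: one_AutoGroup)

lemma act_inv_act [simp]:
  assumes "b \<in> carrier B" "x \<in> carrier X"
  shows "\<phi> (inv\<^bsub>B\<^esub> b) (\<phi> b x) = x" "\<phi> b (\<phi> (inv\<^bsub>B\<^esub> b) x) = x"
  using act_mult[of "inv\<^bsub>B\<^esub> b" b x] act_mult[of b "inv\<^bsub>B\<^esub> b" x] assms by (simp_all add: act_one)

lemma group_semidirect: "group S"
proof (rule groupI)
  fix a assume "a \<in> carrier S"
  then obtain x b where a: "a = (x, b)" "x \<in> carrier X" "b \<in> carrier B" by auto
  \<comment> \<open>The left inverse is forced: its second coordinate must be \<open>inv b\<close>,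
    and the first must then cancel \<open>\<phi> (inv b) x\<close>. Since
    \<open>\<phi> (inv b)\<close> is a homomorphism, this is its value at
    \<open>inv x\<close>.\<close>
  then have "(\<phi> (inv\<^bsub>B\<^esub> b) (inv\<^bsub>X\<^esub> x), inv\<^bsub>B\<^esub> b) \<otimes>\<^bsub>S\<^esub> a = \<one>\<^bsub>S\<^esub>"
    by (simp flip: act_distrib)
  then show "\<exists>a' \<in> carrier S. a' \<otimes>\<^bsub>S\<^esub> a = \<one>\<^bsub>S\<^esub>"
    using a by (intro bexI[of _ "(\<phi> (inv\<^bsub>B\<^esub> b) (inv\<^bsub>X\<^esub> x), inv\<^bsub>B\<^esub> b)"]) auto
qed (auto simp: act_distrib act_mult act_one X.m_assoc B.m_assoc)

lemma inv_semidirect: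
  assumes "x \<in> carrier X" "b \<in> carrier B"
  shows "inv\<^bsub>S\<^esub> (x, b) = (\<phi> (inv\<^bsub>B\<^esub> b) (inv\<^bsub>X\<^esub> x), inv\<^bsub>B\<^esub> b)"
proof (rule group.inv_equality[OF group_semidirect])
  show "(\<phi> (inv\<^bsub>B\<^esub> b) (inv\<^bsub>X\<^esub> x), inv\<^bsub>B\<^esub> b) \<otimes>\<^bsub>S\<^esub> (x, b) = \<one>\<^bsub>S\<^esub>"
    using assms by (simp flip: act_distrib)
qed (use assms in auto)

text \<open>Kernel and section together generate the semidirect product, so a homomorphism out of it
  is determined by its restrictions to these two parts.\<close>

lemma semidirect_factor: "\<lbrakk>x \<in> carrier X; b \<in> carrier B\<rbrakk>
    \<Longrightarrow> (x, b) = (x, \<one>\<^bsub>B\<^esub>) \<otimes>\<^bsub>S\<^esub> (\<one>\<^bsub>X\<^esub>, b)"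
  by (simp add: act_one)

end

text \<open>As groups, the sequence is always a split extension, so only order conditions remain:
  the kernel has the induced order, and projection and section preserve positivity. The cokernel
  property comes from the section: a morphism \<open>g\<close> killing the kernel factors through
  the projection as \<open>g\<close> after the section, which is monotone.\<close>

lemma semidirect_split_extensionI:
  fixes X :: "'x ordgrp" and B :: "'b ordgrp"
  assumes "ordered_group X" "ordered_group B" and action: "\<phi> \<in> hom B (AutoGroup X)"
    and total: "ordered_group (with_order (semidirect X B \<phi>) r)"
    and ker: "\<And>x y. \<lbrakk>x \<in> carrier X; y \<in> carrier X\<rbrakk> \<Longrightarrow> r (x, \<one>\<^bsub>B\<^esub>) (y, \<one>\<^bsub>B\<^esub>) \<longleftrightarrow> x \<preceq>\<^bsub>X\<^esub> y"
    and proj: "\<And>x b. \<lbrakk>x \<in> carrier X; b \<in> carrier B; r (\<one>\<^bsub>X\<^esub>, \<one>\<^bsub>B\<^esub>) (x, b)\<rbrakk> \<Longrightarrow> \<one>\<^bsub>B\<^esub> \<preceq>\<^bsub>B\<^esub> b"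
    and sect: "\<And>b. \<lbrakk>b \<in> carrier B; \<one>\<^bsub>B\<^esub> \<preceq>\<^bsub>B\<^esub> b\<rbrakk> \<Longrightarrow> r (\<one>\<^bsub>X\<^esub>, \<one>\<^bsub>B\<^esub>) (\<one>\<^bsub>X\<^esub>, b)"
  shows "split_extension T X (semidirect_point X B \<phi> r)"
proof -
  interpret X: ordered_group X by fact
  interpret B: ordered_group B by fact
  interpret semidirect_action X B \<phi> by unfold_locales fact
  let ?A = "with_order S r"
  let ?k = "\<lambda>x \<in> carrier X. (x, \<one>\<^bsub>B\<^esub>)"
  let ?f = "\<lambda>(x, b) \<in> carrier X \<times> carrier B. b"
  let ?s = "\<lambda>b \<in> carrier B. (\<one>\<^bsub>X\<^esub>, b)"
  interpret A: ordered_group ?A by fact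
  have k: "?k \<in> ord_hom X ?A"
    by (auto simp: ord_hom_def hom_def monotone_on_def ker act_one)
  have f: "?f \<in> ord_hom ?A B"
  proof -
    have "?f \<in> hom ?A B" by (auto simp: hom_def)
    moreover from this have "monotone_on (carrier ?A) (leq ?A) (leq B) ?f"
      by (rule A.monotone_homI[OF B.ordered_group_axioms]) (auto intro: proj)
    ultimately show ?thesis by (simp add: ord_hom_def)
  qed
  have s: "?s \<in> ord_hom B ?A"
  proof -
    have "?s \<in> hom B ?A" by (auto simp: hom_def)
    moreover from this have "monotone_on (carrier B) (leq B) (leq ?A) ?s"
      by (rule B.monotone_homI[OF A.ordered_group_axioms]) (auto intro: sect)
    ultimately show ?thesis by (simp add: ord_hom_def)
  qed
  have kernel: "is_kernel X ?k ?A ?f B"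
    using k by (auto simp: is_kernel_def inj_on_def kernel_def ker)
  have cokernel: "is_cokernel T X ?k ?A ?f B"
    unfolding is_cokernel_def
  proof (intro conjI allI impI)
    fix C :: "'c ordgrp" and g
    assume "ordered_group C \<and> g \<in> ord_hom ?A C \<and> (\<forall>x \<in> carrier X. g (?k x) = \<one>\<^bsub>C\<^esub>)"
    then have C: "ordered_group C" and g: "g \<in> ord_hom ?A C"
      and gk: "\<And>x. x \<in> carrier X \<Longrightarrow> g (x, \<one>\<^bsub>B\<^esub>) = \<one>\<^bsub>C\<^esub>" by auto
    interpret C: ordered_group C by fact
    have g_hom: "g \<in> hom ?A C" and g_ext: "g \<in> extensional (carrier X \<times> carrier B)"
      and g_mono: "monotone_on (carrier ?A) (leq ?A) (leq C) g"
      using g by (auto simp: ord_hom_def)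
    have g_closed: "g (x, b) \<in> carrier C" if "x \<in> carrier X" "b \<in> carrier B" for x b
      using hom_in_carrier[OF g_hom, of "(x, b)"] that by simp
    \<comment> \<open>Factoring \<open>(x, b)\<close> into a kernel part and a section part,
      \<open>g\<close> kills the former, so its value depends on \<open>b\<close> alone.\<close>
    have g_eq: "g (x, b) = g (\<one>\<^bsub>X\<^esub>, b)" if "x \<in> carrier X" "b \<in> carrier B" for x b
      using hom_mult[OF g_hom, of "(x, \<one>\<^bsub>B\<^esub>)" "(\<one>\<^bsub>X\<^esub>, b)"] that
      by (simp add: act_one gk g_closed)
    show "\<exists>!h. h \<in> ord_hom B C \<and> compose (carrier ?A) h ?f = g"
    proof (rule ex1I)
      let ?h = "compose (carrier B) g ?s"
      have s_hom: "?s \<in> hom B ?A" and s_mono: "monotone_on (carrier B) (leq B) (leq ?A) ?s"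
        using s by (simp_all only: ord_hom_def mem_Collect_eq Int_iff)
      have "?h \<in> hom B C"
        by (rule B.hom_compose[OF s_hom g_hom])
      moreover have "monotone_on (carrier B) (leq B) (leq C) ?h"
      proof (rule monotone_onI)
        fix b c assume bc: "b \<in> carrier B" "c \<in> carrier B" "b \<preceq>\<^bsub>B\<^esub> c"
        have "g (?s b) \<preceq>\<^bsub>C\<^esub> g (?s c)"
          by (rule monotone_onD[OF g_mono _ _ monotone_onD[OF s_mono bc]]) (use bc in auto)
        then show "?h b \<preceq>\<^bsub>C\<^esub> ?h c"
          using bc by (simp add: compose_eq)
      qed
      moreover have "compose (carrier ?A) ?h ?f = g"
        using g_ext by (intro extensionalityI[of _ "carrier X \<times> carrier B"])
          (auto simp: compose_eq intro: g_eq[symmetric])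
      ultimately show "?h \<in> ord_hom B C \<and> compose (carrier ?A) ?h ?f = g"
        by (simp add: ord_hom_def)
    next
      fix h assume h: "h \<in> ord_hom B C \<and> compose (carrier ?A) h ?f = g"
      \<comment> \<open>Since the projection is surjective, with \<open>(\<one>, b)\<close> lying
        over \<open>b\<close>, the factorisation determines \<open>h\<close>.\<close>
      have "h b = g (\<one>\<^bsub>X\<^esub>, b)" if "b \<in> carrier B" for b
        using that h by (auto simp: compose_eq)
      then show "h = compose (carrier B) g ?s"
        using h by (intro extensionalityI[of _ "carrier B"]) (auto simp: ord_hom_def compose_eq)
    qed
  qed (use f in auto)
  show ?thesis
    using s kernel cokernel total X.ordered_group_axioms B.ordered_group_axioms
    by (auto simp: split_extension_def)
qed

section \<open>Consequences of a split extension structure on a semidirect product\<close>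

locale semidirect_split_extension =
  fixes T :: "'c itself" and X :: "'x ordgrp" and B :: "'b ordgrp" and \<phi> r
  assumes action: "\<phi> \<in> hom B (AutoGroup X)"
    and split_ext: "split_extension T X (semidirect_point X B \<phi> r)"

sublocale semidirect_split_extension \<subseteq> X: ordered_group X
  using split_ext by (simp add: split_extension_def)

sublocale semidirect_split_extension \<subseteq> B: ordered_group B
  using split_ext by (simp add: split_extension_def)

sublocale semidirect_split_extension \<subseteq> semidirect_action X B \<phi>
  by unfold_locales (rule action)

sublocale semidirect_split_extension \<subseteq> A: ordered_group "with_order (semidirect X B \<phi>) r"
  using split_ext by (simp add: split_extension_def)

context semidirect_split_extension
begin

lemma kernel_le_iff:
  "\<lbrakk>x \<in> carrier X; y \<in> carrier X\<rbrakk> \<Longrightarrow> r (x, \<one>\<^bsub>B\<^esub>) (y, \<one>\<^bsub>B\<^esub>) \<longleftrightarrow> x \<preceq>\<^bsub>X\<^esub> y"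
  using split_ext by (auto simp: split_extension_def is_kernel_def)

lemma base_pos:
  assumes "x \<in> carrier X" "b \<in> carrier B" "r (\<one>\<^bsub>X\<^esub>, \<one>\<^bsub>B\<^esub>) (x, b)"
  shows "\<one>\<^bsub>B\<^esub> \<preceq>\<^bsub>B\<^esub> b"
proof -
  have "monotone_on (carrier X \<times> carrier B) r (leq B) (\<lambda>(x, b) \<in> carrier X \<times> carrier B. b)"
    using split_ext by (simp add: split_extension_def is_cokernel_def ord_hom_def)
  from monotone_onD[OF this _ _ assms(3)] show ?thesis using assms by simp
qed

text \<open>The action is recovered inside the total group as conjugation by section elements; this
  lets the order on the total group constrain \<open>\<phi>\<close>.\<close>

lemma conj_section:
  assumes "x \<in> carrier X" "b \<in> carrier B"
  shows "(\<one>\<^bsub>X\<^esub>, b) \<otimes>\<^bsub>S\<^esub> (x, \<one>\<^bsub>B\<^esub>) \<otimes>\<^bsub>S\<^esub> inv\<^bsub>S\<^esub> (\<one>\<^bsub>X\<^esub>, b) = (\<phi> b x, \<one>\<^bsub>B\<^esub>)"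
  using assms by (simp add: inv_semidirect)

text \<open>Conjugation in the total group is monotone, and the kernel carries the order of
  \<open>X\<close>.\<close>

lemma act_mono:
  assumes "b \<in> carrier B" "x \<in> carrier X" "y \<in> carrier X" "x \<preceq>\<^bsub>X\<^esub> y"
  shows "\<phi> b x \<preceq>\<^bsub>X\<^esub> \<phi> b y"
  using A.conj_mono[of "(x, \<one>\<^bsub>B\<^esub>)" "(y, \<one>\<^bsub>B\<^esub>)" "(\<one>\<^bsub>X\<^esub>, b)"] assms
  by (simp add: kernel_le_iff conj_section del: semidirect_simps(2))

text \<open>Monotonicity of \<open>\<phi> (inv b)\<close> gives the reflecting direction. Hence an
  action by plain group automorphisms takes values in \<open>Aut X\<close>, so \<open>\<phi>\<close>
  can serve as the map to the classifying base.\<close>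

lemma act_Aut: "b \<in> carrier B \<Longrightarrow> \<phi> b \<in> carrier (Aut X)"
proof (rule AutI)
  fix x y assume "b \<in> carrier B" "x \<in> carrier X" "y \<in> carrier X"
  then show "\<phi> b x \<preceq>\<^bsub>X\<^esub> \<phi> b y \<longleftrightarrow> x \<preceq>\<^bsub>X\<^esub> y"
    using act_mono[of b x y] act_mono[of "inv\<^bsub>B\<^esub> b" "\<phi> b x" "\<phi> b y"] by auto
qed (rule act_auto)

lemma action_Aut: "\<phi> \<in> hom B (Aut X)"
  using action act_Aut by (auto simp: hom_def Aut_one_mult)

end


section \<open>The lexicographic order\<close>

context ordered_group
begin

text \<open>Each of two positive factors lies below their product, so a product bounded by the unit
  bounds both.\<close>

lemma mult_le_one_cancel:
  assumes "\<one> \<preceq> x" "\<one> \<preceq> y" "x \<otimes> y \<preceq> \<one>" "x \<in> carrier G" "y \<in> carrier G"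
  shows "x \<preceq> \<one>" "y \<preceq> \<one>"
proof -
  have "x \<preceq> x \<otimes> y" using mult_mono[of x x \<one> y] assms by simp
  then show "x \<preceq> \<one>" by (rule le_trans) (use assms in auto)
  have "y \<preceq> x \<otimes> y" using mult_mono[of \<one> x y y] assms by simp
  then show "y \<preceq> \<one>" by (rule le_trans) (use assms in auto)
qed

lemma conj_le_one_cancel:
  assumes "g \<otimes> x \<otimes> inv g \<preceq> \<one>" "x \<in> carrier G" "g \<in> carrier G"
  shows "x \<preceq> \<one>"
proof -
  have "inv g \<otimes> (g \<otimes> x \<otimes> inv g) \<otimes> inv (inv g) = x"
    using assms(2,3) by (simp add: m_assoc) (simp flip: m_assoc)
  moreover have "inv g \<otimes> (g \<otimes> x \<otimes> inv g) \<otimes> inv (inv g) \<preceq> inv g \<otimes> \<one> \<otimes> inv (inv g)"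
    by (rule conj_mono) (use assms in auto)
  ultimately show ?thesis
    using assms(2,3) by simp
qed

end

text \<open>Both alternatives in the cone contain \<open>\<one> \<preceq> b\<close>, and whether
  \<open>b \<preceq> \<one>\<close> decides between them. The disjunction thus becomes a condition
  on \<open>x\<close> that is active only when \<open>b\<close> is equivalent to the unit.\<close>

lemma mem_lex_cone_iff:
  "(x, b) \<in> lex_cone X B \<longleftrightarrow> x \<in> carrier X \<and> b \<in> carrier B \<and> \<one>\<^bsub>B\<^esub> \<preceq>\<^bsub>B\<^esub> b \<and>
    (b \<preceq>\<^bsub>B\<^esub> \<one>\<^bsub>B\<^esub> \<longrightarrow> \<one>\<^bsub>X\<^esub> \<preceq>\<^bsub>X\<^esub> x)"
  by (auto simp: lex_cone_def leq_equiv_def)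

text \<open>The condition on \<open>X\<close> matters only over base elements equivalent to the
  unit. There \<open>act_le\<close> controls the twist by the action, and over all other positive
  base elements the first coordinate is free. For the maximal point, \<open>act_le\<close> is
  supplied by admissibility.\<close>

lemma positive_cone_lex_cone:
  fixes X :: "'x ordgrp" and B :: "'b ordgrp"
  assumes "ordered_group X" "ordered_group B" "\<phi> \<in> hom B (AutoGroup X)"
    and act_mono: "\<And>b x y. \<lbrakk>b \<in> carrier B; x \<in> carrier X; y \<in> carrier X; x \<preceq>\<^bsub>X\<^esub> y\<rbrakk>
      \<Longrightarrow> \<phi> b x \<preceq>\<^bsub>X\<^esub> \<phi> b y"
    and act_le: "\<And>b x. \<lbrakk>b \<in> carrier B; b \<sim>\<^bsub>B\<^esub> \<one>\<^bsub>B\<^esub>; x \<in> carrier X\<rbrakk> \<Longrightarrow> x \<preceq>\<^bsub>X\<^esub> \<phi> b x"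
  shows "positive_cone (semidirect X B \<phi>) (lex_cone X B)"
proof -
  interpret X: ordered_group X by fact
  interpret B: ordered_group B by fact
  interpret semidirect_action X B \<phi> by unfold_locales fact
  have act_pos: "\<one>\<^bsub>X\<^esub> \<preceq>\<^bsub>X\<^esub> \<phi> b x" if "b \<in> carrier B" "x \<in> carrier X" "\<one>\<^bsub>X\<^esub> \<preceq>\<^bsub>X\<^esub> x" for b x
    using act_mono[of b "\<one>\<^bsub>X\<^esub>" x] that by simp
  have "submonoid (lex_cone X B) S"
  proof (rule submonoid.intro)
    fix p q assume pq: "p \<in> lex_cone X B" "q \<in> lex_cone X B"
    obtain x b y c where eq: "p = (x, b)" "q = (y, c)" by (cases p, cases q)
    have mem: "x \<in> carrier X" "b \<in> carrier B" "y \<in> carrier X" "c \<in> carrier B"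
      and pos: "\<one>\<^bsub>B\<^esub> \<preceq>\<^bsub>B\<^esub> b" "\<one>\<^bsub>B\<^esub> \<preceq>\<^bsub>B\<^esub> c"
      and x: "b \<preceq>\<^bsub>B\<^esub> \<one>\<^bsub>B\<^esub> \<Longrightarrow> \<one>\<^bsub>X\<^esub> \<preceq>\<^bsub>X\<^esub> x"
      and y: "c \<preceq>\<^bsub>B\<^esub> \<one>\<^bsub>B\<^esub> \<Longrightarrow> \<one>\<^bsub>X\<^esub> \<preceq>\<^bsub>X\<^esub> y"
      using pq by (auto simp: eq mem_lex_cone_iff)
    \<comment> \<open>If the product of the base coordinates is below the unit, so are both of them;
      hence \<open>x\<close> and \<open>y\<close> are both positive, and \<open>\<phi> b\<close>
      preserves positivity of \<open>y\<close>.\<close>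
    have "\<one>\<^bsub>X\<^esub> \<preceq>\<^bsub>X\<^esub> x \<otimes>\<^bsub>X\<^esub> \<phi> b y" if "b \<otimes>\<^bsub>B\<^esub> c \<preceq>\<^bsub>B\<^esub> \<one>\<^bsub>B\<^esub>"
      using B.mult_le_one_cancel[OF pos that] mem x y by (simp add: X.one_le_mult act_pos)
    then show "p \<otimes>\<^bsub>S\<^esub> q \<in> lex_cone X B"
      using mem pos by (simp add: eq mem_lex_cone_iff B.one_le_mult)
  next
    show "lex_cone X B \<subseteq> carrier S" by (auto simp: lex_cone_def)
  qed (simp add: mem_lex_cone_iff)
  moreover have "g \<otimes>\<^bsub>S\<^esub> p \<otimes>\<^bsub>S\<^esub> inv\<^bsub>S\<^esub> g \<in> lex_cone X B"
    if "g \<in> carrier S" "p \<in> lex_cone X B" for g p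
  proof -
    obtain y b x a where eq: "g = (y, b)" "p = (x, a)" by (cases g, cases p)
    then have mem: "y \<in> carrier X" "b \<in> carrier B" "x \<in> carrier X" "a \<in> carrier B"
      and a: "\<one>\<^bsub>B\<^esub> \<preceq>\<^bsub>B\<^esub> a" and x: "a \<preceq>\<^bsub>B\<^esub> \<one>\<^bsub>B\<^esub> \<Longrightarrow> \<one>\<^bsub>X\<^esub> \<preceq>\<^bsub>X\<^esub> x"
      using that by (auto simp: mem_lex_cone_iff)
    let ?c = "b \<otimes>\<^bsub>B\<^esub> a \<otimes>\<^bsub>B\<^esub> inv\<^bsub>B\<^esub> b"
    let ?z = "y \<otimes>\<^bsub>X\<^esub> \<phi> b x \<otimes>\<^bsub>X\<^esub> \<phi> ?c (inv\<^bsub>X\<^esub> y)"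
    \<comment> \<open>The action of \<open>b \<otimes> a\<close> on the first coordinate of
      \<open>inv g\<close> combines with the \<open>\<phi> (inv b)\<close> already there to give
      \<open>\<phi> ?c\<close>.\<close>
    have conj: "g \<otimes>\<^bsub>S\<^esub> p \<otimes>\<^bsub>S\<^esub> inv\<^bsub>S\<^esub> g = (?z, ?c)"
      using mem by (simp add: eq inv_semidirect act_mult)
    have c: "?c \<in> carrier B" "\<one>\<^bsub>B\<^esub> \<preceq>\<^bsub>B\<^esub> ?c"
      using mem a by (auto intro: B.one_le_conj)
    \<comment> \<open>\<open>?z\<close> differs from the true conjugate of \<open>\<phi> b x\<close>
      by \<open>y\<close> only in its last factor. Here \<open>?c\<close> is equivalent to the unit,
      so \<open>act_le\<close> puts \<open>inv y\<close> below \<open>\<phi> ?c (inv y)\<close>, and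
      \<open>?z\<close> lies above a positive element.\<close>
    have "\<one>\<^bsub>X\<^esub> \<preceq>\<^bsub>X\<^esub> ?z" if "?c \<preceq>\<^bsub>B\<^esub> \<one>\<^bsub>B\<^esub>"
    proof -
      have "\<one>\<^bsub>X\<^esub> \<preceq>\<^bsub>X\<^esub> \<phi> b x"
        using x[OF B.conj_le_one_cancel[OF that]] mem act_pos by simp
      then have "\<one>\<^bsub>X\<^esub> \<preceq>\<^bsub>X\<^esub> y \<otimes>\<^bsub>X\<^esub> \<phi> b x \<otimes>\<^bsub>X\<^esub> inv\<^bsub>X\<^esub> y"
        using mem by (simp add: X.one_le_conj)
      moreover have "inv\<^bsub>X\<^esub> y \<preceq>\<^bsub>X\<^esub> \<phi> ?c (inv\<^bsub>X\<^esub> y)"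
        using act_le[of ?c] mem c that by (simp add: leq_equiv_def)
      then have "y \<otimes>\<^bsub>X\<^esub> \<phi> b x \<otimes>\<^bsub>X\<^esub> inv\<^bsub>X\<^esub> y \<preceq>\<^bsub>X\<^esub> ?z"
        using mem c by (intro X.mult_mono) auto
      ultimately show ?thesis
        by (rule X.le_trans) (use mem c in auto)
    qed
    then show ?thesis
      using mem c by (simp add: conj mem_lex_cone_iff)
  qed
  ultimately show ?thesis by (simp add: positive_cone_def)
qed

text \<open>Over the unit of \<open>B\<close> the lexicographic condition reduces to the order of
  \<open>X\<close>, so the kernel order is right. Every element of the cone has positive base
  coordinate, and \<open>(\<one>, b)\<close> belongs to it for each positive
  \<open>b\<close>.\<close>

lemma lex_cone_split_extension:
  fixes X :: "'x ordgrp" and B :: "'b ordgrp"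
  assumes X: "ordered_group X" and B: "ordered_group B" and action: "\<phi> \<in> hom B (AutoGroup X)"
    and cone: "positive_cone (semidirect X B \<phi>) (lex_cone X B)"
  shows "split_extension T X
    (semidirect_point X B \<phi> (leq (with_cone (semidirect X B \<phi>) (lex_cone X B))))"
proof -
  interpret X: ordered_group X by fact
  interpret B: ordered_group B by fact
  interpret semidirect_action X B \<phi> by unfold_locales fact
  have diff: "(y, b) \<otimes>\<^bsub>S\<^esub> inv\<^bsub>S\<^esub> (x, \<one>\<^bsub>B\<^esub>) = (y \<otimes>\<^bsub>X\<^esub> \<phi> b (inv\<^bsub>X\<^esub> x), b)"
    if "x \<in> carrier X" "y \<in> carrier X" "b \<in> carrier B" for x y b
    using that by (simp add: inv_semidirect act_one)
  show ?thesis
  proof (rule semidirect_split_extensionI[OF X B action])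
    show "ordered_group (with_order S (leq (with_cone S (lex_cone X B))))"
      unfolding with_cone_eq_with_order
      using cone by (intro ordered_group_with_cone group_semidirect)
  next
    fix x y assume "x \<in> carrier X" "y \<in> carrier X"
    then show "leq (with_cone S (lex_cone X B)) (x, \<one>\<^bsub>B\<^esub>) (y, \<one>\<^bsub>B\<^esub>) \<longleftrightarrow> x \<preceq>\<^bsub>X\<^esub> y"
      by (simp add: diff act_one mem_lex_cone_iff X.le_iff_one_le[of x y] del: semidirect_simps(2))
  qed (simp_all add: diff mem_lex_cone_iff del: semidirect_simps(2))
qed


section \<open>The classifying point\<close>

theorem proposition5p5:
  fixes X :: "'x ordgrp" and P :: "('x \<Rightarrow> 'x) set"
  assumes "ordered_group X"
    and "admissible_cone X P"
  shows "maximal_point X P \<in> S_cat TYPE('c) X P \<and>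
    (\<forall>E :: ('x, 'x \<times> 'b, 'b) point. E \<in> S_cat TYPE('c) X P \<longrightarrow>
      (\<exists>!m. m \<in> point_hom X E (maximal_point X P)))"
proof (intro conjI allI impI)
  interpret X: ordered_group X by fact
  let ?A = "Aut_ord X P"
  let ?L = "with_cone (semidirect X ?A (\<lambda>\<alpha>. \<alpha>)) (lex_cone X ?A)"
  have cone: "positive_cone (Aut X) P"
    and admissible: "\<And>\<alpha> x. \<lbrakk>\<alpha> \<in> carrier (Aut X); \<alpha> \<sim>\<^bsub>?A\<^esub> \<one>\<^bsub>Aut X\<^esub>; x \<in> carrier X\<rbrakk> \<Longrightarrow> \<alpha> x \<sim>\<^bsub>X\<^esub> x"
    using assms(2) by (auto simp: admissible_cone_def)
  have groupA: "group (Aut X)"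
    by (rule group_Aut[OF X.is_group])
  have A: "ordered_group ?A"
    by (rule ordered_group_with_cone[OF groupA cone])
  interpret A: ordered_group ?A by (rule A)
  \<comment> \<open>The tautological action: each automorphism acts on \<open>X\<close> as
    itself.\<close>
  have id_hom: "(\<lambda>\<alpha>. \<alpha>) \<in> hom ?A (AutoGroup X)"
    by (auto simp: hom_def Aut_one_mult carrier_AutoGroup dest: Aut_subset_auto)
  have one_le_iff: "\<one>\<^bsub>Aut X\<^esub> \<preceq>\<^bsub>?A\<^esub> \<alpha> \<longleftrightarrow> \<alpha> \<in> P" if "\<alpha> \<in> carrier (Aut X)" for \<alpha>
    using group.is_monoid[OF groupA] that by (simp add: monoid.inv_one monoid.r_one)
  have lex: "positive_cone (semidirect X ?A (\<lambda>\<alpha>. \<alpha>)) (lex_cone X ?A)"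
  proof (rule positive_cone_lex_cone[OF assms(1) A id_hom])
    fix \<alpha> x y assume "\<alpha> \<in> carrier ?A" "x \<in> carrier X" "y \<in> carrier X" "x \<preceq>\<^bsub>X\<^esub> y"
    then show "\<alpha> x \<preceq>\<^bsub>X\<^esub> \<alpha> y" by (simp add: Aut_le_iff)
  next
    \<comment> \<open>Admissibility enters here: an automorphism equivalent to the identity moves
      each point only within its equivalence class.\<close>
    fix \<alpha> x assume "\<alpha> \<in> carrier ?A" "\<alpha> \<sim>\<^bsub>?A\<^esub> \<one>\<^bsub>?A\<^esub>" "x \<in> carrier X"
    then show "x \<preceq>\<^bsub>X\<^esub> \<alpha> x" using admissible[of \<alpha> x] by (simp add: leq_equiv_def)
  qed
  have max_split: "split_extension TYPE('c) X (semidirect_point X ?A (\<lambda>\<alpha>. \<alpha>) (leq ?L))"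
    by (rule lex_cone_split_extension[OF assms(1) A id_hom lex])
  interpret M: semidirect_split_extension "TYPE('c)" X ?A "\<lambda>\<alpha>. \<alpha>" "leq ?L"
    by (rule semidirect_split_extension.intro[OF id_hom max_split])
  have one_le_lex_iff: "leq ?L (\<one>\<^bsub>X\<^esub>, \<one>\<^bsub>Aut X\<^esub>) p \<longleftrightarrow> p \<in> lex_cone X ?A"
    if "p \<in> carrier X \<times> carrier (Aut X)" for p
  proof -
    have "p \<otimes>\<^bsub>M.S\<^esub> inv\<^bsub>M.S\<^esub> \<one>\<^bsub>M.S\<^esub> = p"
      using group.is_monoid[OF M.group_semidirect] that
      by (simp add: monoid.inv_one monoid.r_one del: semidirect_simps(3))
    then show ?thesis by simp
  qed

  show "maximal_point X P \<in> S_cat TYPE('c) X P"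
    unfolding S_cat_def maximal_point_def
  proof (intro CollectI exI conjI ballI impI)
    fix \<alpha> assume "\<alpha> \<in> pos_cone ?A"
    then show "\<alpha> \<in> P" using one_le_iff[of \<alpha>] by (auto simp: pos_cone_def)
  next
    \<comment> \<open>Condition (2) for the maximal point: when \<open>\<alpha>\<close> is also
      below the identity, membership in the lexicographic cone forces \<open>x\<close> to be
      positive.\<close>
    fix x assume x: "x \<in> carrier X" and
      "\<exists>\<alpha> \<in> pos_cone ?A. leq ?L (\<one>\<^bsub>X\<^esub>, \<one>\<^bsub>?A\<^esub>) (x, \<alpha>) \<and> \<alpha> \<sim>\<^bsub>?A\<^esub> \<one>\<^bsub>Aut X\<^esub>"
    then obtain \<alpha> where "\<alpha> \<in> carrier (Aut X)" "leq ?L (\<one>\<^bsub>X\<^esub>, \<one>\<^bsub>?A\<^esub>) (x, \<alpha>)" "\<alpha> \<preceq>\<^bsub>?A\<^esub> \<one>\<^bsub>?A\<^esub>"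
      by (auto simp: pos_cone_def leq_equiv_def simp del: with_cone_simps(4))
    then show "\<one>\<^bsub>X\<^esub> \<preceq>\<^bsub>X\<^esub> x"
      using x by (simp add: one_le_lex_iff mem_lex_cone_iff del: with_cone_simps(4))
  qed (rule refl id_hom max_split)+

  fix E :: "('x, 'x \<times> 'b, 'b) point"
  assume "E \<in> S_cat TYPE('c) X P"
  then obtain B \<phi> r where E: "E = semidirect_point X B \<phi> r"
    and action: "\<phi> \<in> hom B (AutoGroup X)"
    and split_ext: "split_extension TYPE('c) X (semidirect_point X B \<phi> r)"
    and act_pos: "\<And>b. b \<in> pos_cone B \<Longrightarrow> \<phi> b \<in> P"
    and ker_pos: "\<And>x b. \<lbrakk>x \<in> carrier X; b \<in> pos_cone B; r (\<one>\<^bsub>X\<^esub>, \<one>\<^bsub>B\<^esub>) (x, b);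
      \<phi> b \<sim>\<^bsub>?A\<^esub> \<one>\<^bsub>Aut X\<^esub>\<rbrakk> \<Longrightarrow> \<one>\<^bsub>X\<^esub> \<preceq>\<^bsub>X\<^esub> x"
    unfolding S_cat_def by blast
  interpret E: semidirect_split_extension "TYPE('c)" X B \<phi> r
    by (rule semidirect_split_extension.intro[OF action split_ext])
  \<comment> \<open>Restriction to the carrier makes \<open>\<phi>\<close> extensional, as morphisms
    are required to be; otherwise uniqueness would fail off the carrier.\<close>
  let ?c = "restrict \<phi> (carrier B)"
  let ?t = "\<lambda>(x, b) \<in> carrier X \<times> carrier B. (x, \<phi> b)"
  have c: "?c \<in> ord_hom B ?A"
  proof -
    have "?c \<in> hom B ?A"
      using E.action_Aut by (auto simp: hom_def)
    moreover from this have "monotone_on (carrier B) (leq B) (leq ?A) ?c"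
    proof (rule E.B.monotone_homI[OF A])
      fix b assume b: "b \<in> carrier B" "\<one>\<^bsub>B\<^esub> \<preceq>\<^bsub>B\<^esub> b"
      then have "\<phi> b \<in> P" by (intro act_pos) (simp add: pos_cone_def)
      then show "\<one>\<^bsub>?A\<^esub> \<preceq>\<^bsub>?A\<^esub> ?c b"
        using one_le_iff[of "\<phi> b"] b by (simp add: E.act_Aut del: with_cone_simps(4))
    qed
    ultimately show ?thesis by (simp add: ord_hom_def)
  qed
  have t: "?t \<in> ord_hom (with_order E.S r) (with_order M.S (leq ?L))"
  proof -
    have "?t \<in> hom (with_order E.S r) (with_order M.S (leq ?L))"
      using hom_mult[OF E.action_Aut] by (auto simp: hom_def E.act_Aut)
    moreover from this have "monotone_on (carrier (with_order E.S r)) (leq (with_order E.S r))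
        (leq (with_order M.S (leq ?L))) ?t"
    proof (rule E.A.monotone_homI[OF M.A.ordered_group_axioms])
      fix p assume "p \<in> carrier (with_order E.S r)"
        "leq (with_order E.S r) \<one>\<^bsub>with_order E.S r\<^esub> p"
      then obtain x b where p: "p = (x, b)" and mem: "x \<in> carrier X" "b \<in> carrier B"
        and le: "r (\<one>\<^bsub>X\<^esub>, \<one>\<^bsub>B\<^esub>) (x, b)" by auto
      have b: "b \<in> pos_cone B"
        using E.base_pos[OF mem le] mem by (simp add: pos_cone_def)
      then have \<phi>: "\<one>\<^bsub>Aut X\<^esub> \<preceq>\<^bsub>?A\<^esub> \<phi> b"
        using act_pos one_le_iff E.act_Aut mem by blast
      then have "(x, \<phi> b) \<in> lex_cone X ?A"
        using mem ker_pos[OF mem(1) b le]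
        by (simp add: mem_lex_cone_iff leq_equiv_def E.act_Aut del: with_cone_simps(4))
      then show "leq (with_order M.S (leq ?L)) \<one>\<^bsub>with_order M.S (leq ?L)\<^esub> (?t p)"
        using one_le_lex_iff[of "(x, \<phi> b)"] mem
        by (simp add: p E.act_Aut del: with_cone_simps(4))
    qed
    ultimately show ?thesis by (simp add: ord_hom_def)
  qed
  show "\<exists>!m. m \<in> point_hom X E (maximal_point X P)"
  proof (rule ex1I)
    \<comment> \<open>This is what makes \<open>?t\<close> send the kernel inclusion of
      \<open>E\<close> to that of the maximal point.\<close>
    have "\<phi> \<one>\<^bsub>B\<^esub> = \<one>\<^bsub>Aut X\<^esub>"
      by (rule hom_one[OF E.action_Aut E.B.is_group groupA])
    then show "(?t, ?c) \<in> point_hom X E (maximal_point X P)"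
      using t c by (auto simp: point_hom_def E maximal_point_def E.act_Aut)
  next
    fix m assume m: "m \<in> point_hom X E (maximal_point X P)"
    obtain t' c' where m_eq: "m = (t', c')" by (cases m)
    have t'_hom: "t' \<in> hom E.S M.S" and t'_ext: "t' \<in> extensional (carrier X \<times> carrier B)"
      and c'_hom: "c' \<in> hom B (Aut X)" and c'_ext: "c' \<in> extensional (carrier B)"
      using m by (auto simp: m_eq point_hom_def ord_hom_def hom_def E maximal_point_def)
    have t'_ker: "t' (x, \<one>\<^bsub>B\<^esub>) = (x, \<one>\<^bsub>Aut X\<^esub>)" if "x \<in> carrier X" for x
      using m that by (auto simp: m_eq point_hom_def E maximal_point_def)
    have c'_Aut: "c' b \<in> carrier (Aut X)" if "b \<in> carrier B" for b
      by (rule hom_in_carrier[OF c'_hom that])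
    have t'_sect: "t' (\<one>\<^bsub>X\<^esub>, b) = (\<one>\<^bsub>X\<^esub>, c' b)" if "b \<in> carrier B" for b
      using m that c'_Aut[OF that] by (auto simp: m_eq point_hom_def E maximal_point_def)
    have t'_eq: "t' (x, b) = (x, c' b)" if "x \<in> carrier X" "b \<in> carrier B" for x b
    proof -
      have "t' (x, b) = t' (x, \<one>\<^bsub>B\<^esub>) \<otimes>\<^bsub>M.S\<^esub> t' (\<one>\<^bsub>X\<^esub>, b)"
        using that E.semidirect_factor[of x b] hom_mult[OF t'_hom, of "(x, \<one>\<^bsub>B\<^esub>)" "(\<one>\<^bsub>X\<^esub>, b)"]
        by (simp del: semidirect_simps(2))
      also have "\<dots> = (x, c' b)"
        using M.semidirect_factor[of x "c' b"] that
        by (simp add: t'_ker t'_sect c'_Aut)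
      finally show ?thesis .
    qed
    have "c' b x = \<phi> b x" if "b \<in> carrier B" "x \<in> carrier X" for b x
    proof -
      \<comment> \<open>The product of \<open>(\<one>, b)\<close> and \<open>(x, \<one>)\<close> is
        mapped in two ways: multiplying first brings in the action of \<open>E\<close>, and mapping
        first brings in the tautological action of \<open>c' b\<close>. Comparing first coordinates
        identifies the two actions.\<close>
      have "(\<phi> b x, c' b) = t' ((\<one>\<^bsub>X\<^esub>, b) \<otimes>\<^bsub>E.S\<^esub> (x, \<one>\<^bsub>B\<^esub>))"
        using that by (simp add: t'_eq)
      also have "\<dots> = (\<one>\<^bsub>X\<^esub>, c' b) \<otimes>\<^bsub>M.S\<^esub> (x, \<one>\<^bsub>Aut X\<^esub>)"
        using hom_mult[OF t'_hom, of "(\<one>\<^bsub>X\<^esub>, b)" "(x, \<one>\<^bsub>B\<^esub>)"] that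
        by (simp add: t'_ker t'_sect del: semidirect_simps(2))
      finally show ?thesis
        using that M.act_closed[of "c' b" x] by (simp add: c'_Aut)
    qed
    \<comment> \<open>Agreement on \<open>X\<close> becomes equality of functions because
      automorphisms are extensional.\<close>
    then have "c' b = \<phi> b" if "b \<in> carrier B" for b
      using that c'_Aut[THEN Aut_subset_auto, THEN auto_extensional]
        E.act_auto[THEN auto_extensional]
      by (intro extensionalityI[of _ "carrier X"]) auto
    then have "c' = ?c" and "t' = ?t"
      using c'_ext t'_ext t'_eq
      by (auto intro!: extensionalityI[of c' "carrier B"]
        extensionalityI[of t' "carrier X \<times> carrier B"])
    then show "m = (?t, ?c)" by (simp add: m_eq)
  qed
qed

end
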